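(* Let $(\mathcal B,\mathcal L,\theta,\mathcal I)$ be a generalized Boolean dynamical system with countably infinite alphabet $\mathcal L$, and let $(\mathcal B^F,\mathcal L^F,\theta^F,\mathcal I^F)$ be the generalized Boolean dynamical system constructed from it (and a fixed enumeration of $\mathcal L$) as in the context. Then $(\mathcal B^F)_{\mathrm{reg}}=\mathcal B^F$.
   Context: A generalized Boolean algebra $\mathcal B$ is a distributive lattice with relative complements and a least element $\emptyset$; write $\cup,\cap,\setminus,\subseteq$ for join, meet, relative complement and order. Morphisms preserve $\emptyset$ and all operations. An ideal is a nonempty subset closed under $\cup$ and under $\cap$ with arbitrary elements of $\mathcal B$. For an ideal $K$, $\mathcal B/K$ is the generalized Boolean algebra of classes for $A\sim B\iff A\cup U=B\cup U$ for some $U\in K$. A generalized Boolean dynamical system $(\mathcal B,\mathcal L,\theta,\mathcal I)$ consists of a generalized Boolean algebra $\mathcal B$, a set $\mathcal L$, morphisms $\theta_\alpha:\mathcal B\to\mathcal B$ ($\alpha\in\mathcal L$), and ideals $\mathcal I_\alpha$ ($\alpha\in\mathcal L$) with $\{A\in\mathcal B:A\subseteq\theta_\alpha(B)\text{ for some }B\in\mathcal B\}\subseteq\mathcal I_\alpha$. Put $\Delta_A=\{\alpha\in\mathcal L:\theta_\alpha(A)\ne\emptyset\}$, $\mathcal B_{\mathrm{reg}}=\{A\in\mathcal B:0<|\Delta_B|<\infty\text{ for all }\emptyset\ne B\subseteq A\}$, $\mathcal B_{\mathrm{sink}}=\{B\in\mathcal B:\Delta_B=\emptyset\}$. $(\mathcal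 B^F)_{\mathrm{reg}}$ is computed with respect to the system $(\mathcal B^F,\mathcal L^F,\theta^F,\mathcal I^F)$. Construction of $(\mathcal B^F,\mathcal L^F,\theta^F,\mathcal I^F)$: Enumerate $\mathcal L=\{a_1,a_2,\ldots\}$ without repetition. $U\in\mathcal B$ has no sinks if $U\cap B=\emptyset$ for every $B\in\mathcal B_{\mathrm{sink}}$. Let $X_0=\{\emptyset\}$ and, for $i\ge1$, $X_i=\{U\in\mathcal B:U\text{ has no sinks and }\Delta_U\subseteq\{a_1,\ldots,a_{i-1}\}\}$; these are ideals with $X_i\subseteq X_{i+1}$. Let $\mathcal B_i=\mathcal B/X_i$, with $[A]_i$ the class of $A$, and $\mathcal B^F=\bigoplus_{i=0}^\infty\mathcal B_i$ (finitely supported sequences, coordinatewise operations; $[A]_i$ also denotes the element supported in coordinate $i$). Let $\mathcal L^F=\mathcal L\sqcup\{b_1,b_2,\ldots\}$. For $i\ge1$, $\theta^F_{b_i}$ is the morphism with $\theta^F_{b_i}([A]_{i-1})=[A]_i$ and $\theta^F_{b_i}([A]_j)=\emptyset$ for $j\ne i-1$; $\theta^F_{a_i}$ is the morphism with $\theta^F_{a_i}([A]_i)=[\theta_{a_i}(A)]_0$ and $\theta^F_{a_i}([A]_j)=\emptyset$ for $j\neq i$. Let $\mathcal I^F_{a_i}=\{[A]_0:A\in\mathcal I_{a_i}\}$ and $\mathcal I^F_{b_i}=\mathcal B_i$ (the copy in coordinate $i$). *)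

theory Defs
  imports "HOL-Algebra.Lattice"
begin

section \<open>Generalized Boolean algebras\<close>

locale generalized_boolean_algebra = lattice B + weak_partial_order_bottom B
  for B (structure) +
  assumes distributive:
      "\<lbrakk>x \<in> carrier B; y \<in> carrier B; z \<in> carrier B\<rbrakk>
        \<Longrightarrow> x \<sqinter> (y \<squnion> z) = (x \<sqinter> y) \<squnion> (x \<sqinter> z)"
    and relative_complement_exists:
      "\<lbrakk>x \<in> carrier B; y \<in> carrier B\<rbrakk>
        \<Longrightarrow> \<exists>d\<in>carrier B. d \<sqinter> y = \<bottom> \<and> d \<squnion> (x \<sqinter> y) = x"

definition rel_compl :: "('a, 'm) gorder_scheme \<Rightarrow> 'a \<Rightarrow> 'a \<Rightarrow> 'a" where
  "rel_compl B x y =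
     (THE d. d \<in> carrier B \<and> d \<sqinter>\<^bsub>B\<^esub> y = \<bottom>\<^bsub>B\<^esub> \<and> d \<squnion>\<^bsub>B\<^esub> (x \<sqinter>\<^bsub>B\<^esub> y) = x)"

definition gba_morphism ::
  "('a, 'm) gorder_scheme \<Rightarrow> ('b, 'n) gorder_scheme \<Rightarrow> ('a \<Rightarrow> 'b) \<Rightarrow> bool" where
  "gba_morphism B C f \<longleftrightarrow>
     f \<in> carrier B \<rightarrow> carrier C \<and> f \<bottom>\<^bsub>B\<^esub> = \<bottom>\<^bsub>C\<^esub> \<and> join_pres B C f \<and> meet_pres B C f \<and>
     (\<forall>x\<in>carrier B. \<forall>y\<in>carrier B. f (rel_compl B x y) = rel_compl C (f x) (f y))"

definition gba_ideal :: "('a, 'm) gorder_scheme \<Rightarrow> 'a set \<Rightarrow> bool" where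
  "gba_ideal B K \<longleftrightarrow>
     K \<subseteq> carrier B \<and> K \<noteq> {} \<and> (\<forall>x\<in>K. \<forall>y\<in>K. x \<squnion>\<^bsub>B\<^esub> y \<in> K) \<and>
     (\<forall>x\<in>K. \<forall>y\<in>carrier B. x \<sqinter>\<^bsub>B\<^esub> y \<in> K)"

definition ideal_rel :: "('a, 'm) gorder_scheme \<Rightarrow> 'a set \<Rightarrow> ('a \<times> 'a) set" where
  "ideal_rel B K =
     {(x, y). x \<in> carrier B \<and> y \<in> carrier B \<and> (\<exists>u\<in>K. x \<squnion>\<^bsub>B\<^esub> u = y \<squnion>\<^bsub>B\<^esub> u)}"

definition ideal_class :: "('a, 'm) gorder_scheme \<Rightarrow> 'a set \<Rightarrow> 'a \<Rightarrow> 'a set" where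
  "ideal_class B K x = ideal_rel B K `` {x}"

text \<open>The order below is the one belonging to the operations on representatives;
  see \<open>ideal_class_operations\<close>.\<close>

definition quotient_algebra :: "('a, 'm) gorder_scheme \<Rightarrow> 'a set \<Rightarrow> 'a set gorder" where
  "quotient_algebra B K =
     \<lparr>carrier = carrier B // ideal_rel B K, eq = (=),
      le = (\<lambda>C D. \<exists>x\<in>C. \<exists>y\<in>D. x \<sqsubseteq>\<^bsub>B\<^esub> y)\<rparr>"

text \<open>The coordinatewise order has the coordinatewise operations;
  see \<open>direct_sum_operations\<close>.\<close>

definition direct_sum :: "(nat \<Rightarrow> 'a gorder) \<Rightarrow> (nat \<Rightarrow> 'a) gorder" where
  "direct_sum B =
     \<lparr>carrier = {f. (\<forall>i. f i \<in> carrier (B i)) \<and> finite {i. f i \<noteq> \<bottom>\<^bsub>B i\<^esub>}}, eq = (=),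
      le = (\<lambda>f g. \<forall>i. f i \<sqsubseteq>\<^bsub>B i\<^esub> g i)\<rparr>"

definition coord :: "(nat \<Rightarrow> 'a gorder) \<Rightarrow> nat \<Rightarrow> 'a \<Rightarrow> nat \<Rightarrow> 'a" where
  "coord B i x = (\<lambda>j. if j = i then x else \<bottom>\<^bsub>B j\<^esub>)"


section \<open>Generalized Boolean dynamical systems\<close>

record ('a, 'l) gbds =
  algebra :: "'a gorder"
  alphabet :: "'l set"
  act :: "'l \<Rightarrow> 'a \<Rightarrow> 'a"
  act_ideal :: "'l \<Rightarrow> 'a set"

definition generalized_boolean_dynamical_system :: "('a, 'l) gbds \<Rightarrow> bool" where
  "generalized_boolean_dynamical_system S \<longleftrightarrow>
     generalized_boolean_algebra (algebra S) \<and>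
     (\<forall>\<alpha>\<in>alphabet S.
        gba_morphism (algebra S) (algebra S) (act S \<alpha>) \<and>
        gba_ideal (algebra S) (act_ideal S \<alpha>) \<and>
        {A \<in> carrier (algebra S). \<exists>B\<in>carrier (algebra S). A \<sqsubseteq>\<^bsub>algebra S\<^esub> act S \<alpha> B}
          \<subseteq> act_ideal S \<alpha>)"

definition Delta :: "('a, 'l) gbds \<Rightarrow> 'a \<Rightarrow> 'l set" where
  "Delta S A = {\<alpha> \<in> alphabet S. act S \<alpha> A \<noteq> \<bottom>\<^bsub>algebra S\<^esub>}"

definition regular_elements :: "('a, 'l) gbds \<Rightarrow> 'a set" where
  "regular_elements S =
     {A \<in> carrier (algebra S).
        \<forall>B\<in>carrier (algebra S). B \<noteq> \<bottom>\<^bsub>algebra S\<^esub> \<longrightarrow> B \<sqsubseteq>\<^bsub>algebra S\<^esub> A \<longrightarrow>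
          finite (Delta S B) \<and> 0 < card (Delta S B)}"

definition sinks :: "('a, 'l) gbds \<Rightarrow> 'a set" where
  "sinks S = {B \<in> carrier (algebra S). Delta S B = {}}"

definition has_no_sinks :: "('a, 'l) gbds \<Rightarrow> 'a \<Rightarrow> bool" where
  "has_no_sinks S U \<longleftrightarrow> (\<forall>B\<in>sinks S. U \<sqinter>\<^bsub>algebra S\<^esub> B = \<bottom>\<^bsub>algebra S\<^esub>)"


section \<open>The system on the direct sum\<close>

text \<open>Throughout, \<open>a\<close> enumerates the alphabet by the positive integers; the value \<open>a 0\<close> plays
  no role. The letters of the new alphabet are \<open>Inl (a i)\<close> for the old \<open>a i\<close> and \<open>Inr i\<close> for
  \<open>b\<^sub>i\<close>, with \<open>i \<ge> 1\<close> in both cases.\<close>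

definition F_ideal :: "('a, 'l) gbds \<Rightarrow> (nat \<Rightarrow> 'l) \<Rightarrow> nat \<Rightarrow> 'a set" where
  "F_ideal S a i =
     (if i = 0 then {\<bottom>\<^bsub>algebra S\<^esub>}
      else {U \<in> carrier (algebra S). has_no_sinks S U \<and> Delta S U \<subseteq> a ` {1..<i}})"

definition F_class :: "('a, 'l) gbds \<Rightarrow> (nat \<Rightarrow> 'l) \<Rightarrow> nat \<Rightarrow> 'a \<Rightarrow> 'a set" where
  "F_class S a i A = ideal_class (algebra S) (F_ideal S a i) A"

definition F_summand :: "('a, 'l) gbds \<Rightarrow> (nat \<Rightarrow> 'l) \<Rightarrow> nat \<Rightarrow> 'a set gorder" where
  "F_summand S a i = quotient_algebra (algebra S) (F_ideal S a i)"

definition F_algebra :: "('a, 'l) gbds \<Rightarrow> (nat \<Rightarrow> 'l) \<Rightarrow> (nat \<Rightarrow> 'a set) gorder" where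
  "F_algebra S a = direct_sum (F_summand S a)"

abbreviation F_elem :: "('a, 'l) gbds \<Rightarrow> (nat \<Rightarrow> 'l) \<Rightarrow> nat \<Rightarrow> 'a \<Rightarrow> nat \<Rightarrow> 'a set" where
  "F_elem S a i A \<equiv> coord (F_summand S a) i (F_class S a i A)"

definition F_alphabet :: "('a, 'l) gbds \<Rightarrow> ('l + nat) set" where
  "F_alphabet S = Inl ` alphabet S \<union> Inr ` {1..}"

text \<open>For a class \<open>C\<close>, the image \<open>(\<lambda>A. [h A]\<^sub>i) ` C\<close> used below is a singleton in the two
  instances that occur (\<open>h\<close> the identity, respectively \<open>h\<close> the action of \<open>a i\<close>), so
  \<open>the_elem\<close> picks the value of the induced map. The resulting morphisms are characterized by
  \<open>F_act_values\<close> and \<open>F_system_is_gbds\<close>.\<close>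

fun F_act :: "('a, 'l) gbds \<Rightarrow> (nat \<Rightarrow> 'l) \<Rightarrow> 'l + nat \<Rightarrow> (nat \<Rightarrow> 'a set) \<Rightarrow> nat \<Rightarrow> 'a set" where
  "F_act S a (Inr i) f = coord (F_summand S a) i (the_elem (F_class S a i ` f (i - 1)))"
| "F_act S a (Inl \<alpha>) f =
     coord (F_summand S a) 0
       (the_elem ((\<lambda>A. F_class S a 0 (act S \<alpha> A)) ` f (inv_into {1..} a \<alpha>)))"

fun F_act_ideal :: "('a, 'l) gbds \<Rightarrow> (nat \<Rightarrow> 'l) \<Rightarrow> 'l + nat \<Rightarrow> (nat \<Rightarrow> 'a set) set" where
  "F_act_ideal S a (Inr i) = F_elem S a i ` carrier (algebra S)"
| "F_act_ideal S a (Inl \<alpha>) = F_elem S a 0 ` act_ideal S \<alpha>"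

definition F_system :: "('a, 'l) gbds \<Rightarrow> (nat \<Rightarrow> 'l) \<Rightarrow> (nat \<Rightarrow> 'a set, 'l + nat) gbds" where
  "F_system S a =
     \<lparr>algebra = F_algebra S a, alphabet = F_alphabet S,
      act = F_act S a, act_ideal = F_act_ideal S a\<rparr>"

section \<open>Well-definedness of the construction\<close>

subsection \<open>Generalized Boolean algebras\<close>

context generalized_boolean_algebra
begin

lemma meet_bottom: "x \<in> carrier B \<Longrightarrow> x \<sqinter> \<bottom> = \<bottom>"
  by (meson bottom_closed bottom_lower le_antisym meet_closed meet_right)

lemma join_bottom: "x \<in> carrier B \<Longrightarrow> x \<squnion> \<bottom> = x"
  by (metis bottom_closed bottom_lower join_comm le_iff_meet)

lemma le_bottom: "x \<in> carrier B \<Longrightarrow> x \<sqsubseteq> \<bottom> \<Longrightarrow> x = \<bottom>"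
  by (meson bottom_closed bottom_lower le_antisym)

lemma meet_mono:
  "\<lbrakk>x \<sqsubseteq> x'; y \<sqsubseteq> y'; x \<in> carrier B; x' \<in> carrier B; y \<in> carrier B; y' \<in> carrier B\<rbrakk>
    \<Longrightarrow> x \<sqinter> y \<sqsubseteq> x' \<sqinter> y'"
  by (rule meet_le) (auto intro: le_trans[OF meet_left] le_trans[OF meet_right])

lemma join_mono:
  "\<lbrakk>x \<sqsubseteq> x'; y \<sqsubseteq> y'; x \<in> carrier B; x' \<in> carrier B; y \<in> carrier B; y' \<in> carrier B\<rbrakk>
    \<Longrightarrow> x \<squnion> y \<sqsubseteq> x' \<squnion> y'"
  by (rule join_le) (auto intro: le_trans[OF _ join_left] le_trans[OF _ join_right])

lemma rel_compl_le:
  assumes c: "x \<in> carrier B" "y \<in> carrier B" "d \<in> carrier B" "e \<in> carrier B"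
    and d: "d \<sqinter> y = \<bottom>" "d \<squnion> (x \<sqinter> y) = x" and e: "e \<squnion> (x \<sqinter> y) = x"
  shows "d \<sqsubseteq> e"
proof -
  have dx: "d \<sqsubseteq> x" using d(2) c by (metis join_left meet_closed)
  have "d \<sqinter> (x \<sqinter> y) \<sqsubseteq> d \<sqinter> y" using c by (simp add: meet_mono meet_right)
  then have z: "d \<sqinter> (x \<sqinter> y) = \<bottom>" using d(1) c by (simp add: le_bottom)
  have "d = d \<sqinter> x" using dx c le_iff_join by simp
  also have "\<dots> = d \<sqinter> (e \<squnion> (x \<sqinter> y))" using e by simp
  also have "\<dots> = (d \<sqinter> e) \<squnion> (d \<sqinter> (x \<sqinter> y))" using c by (intro distributive) auto
  also have "\<dots> = d \<sqinter> e" using z c by (simp add: join_bottom)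
  finally show ?thesis using c le_iff_join by simp
qed

lemma rel_compl_eqI:
  assumes "x \<in> carrier B" "y \<in> carrier B" "d \<in> carrier B" "d \<sqinter> y = \<bottom>" "d \<squnion> (x \<sqinter> y) = x"
  shows "rel_compl B x y = d"
  unfolding rel_compl_def
  by (rule the_equality) (use assms in \<open>auto intro: le_antisym rel_compl_le\<close>)

lemma rel_compl_props:
  assumes "x \<in> carrier B" "y \<in> carrier B"
  shows "rel_compl B x y \<in> carrier B" "rel_compl B x y \<sqinter> y = \<bottom>"
    "rel_compl B x y \<squnion> (x \<sqinter> y) = x"
  using relative_complement_exists[OF assms] rel_compl_eqI[OF assms] by auto

lemma distributive_dual:
  assumes c: "x \<in> carrier B" "y \<in> carrier B" "z \<in> carrier B"
  shows "(x \<squnion> z) \<sqinter> (y \<squnion> z) = (x \<sqinter> y) \<squnion> z"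
proof (rule le_antisym)
  have "(x \<squnion> z) \<sqinter> (y \<squnion> z) = ((x \<squnion> z) \<sqinter> y) \<squnion> ((x \<squnion> z) \<sqinter> z)"
    using c by (simp add: distributive)
  also have "(x \<squnion> z) \<sqinter> y = (y \<sqinter> x) \<squnion> (y \<sqinter> z)" using c
    by (simp add: distributive meet_comm[of _ _ y])
  finally have e: "(x \<squnion> z) \<sqinter> (y \<squnion> z) = ((y \<sqinter> x) \<squnion> (y \<sqinter> z)) \<squnion> ((x \<squnion> z) \<sqinter> z)" .
  have "(y \<sqinter> x) \<squnion> (y \<sqinter> z) \<sqsubseteq> (x \<sqinter> y) \<squnion> z"
    unfolding meet_comm[of B y x] using c by (intro join_mono) (auto simp: meet_right)
  moreover have "(x \<squnion> z) \<sqinter> z \<sqsubseteq> (x \<sqinter> y) \<squnion> z"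
    using c by (intro le_trans[OF meet_right join_right]) auto
  ultimately show "(x \<squnion> z) \<sqinter> (y \<squnion> z) \<sqsubseteq> (x \<sqinter> y) \<squnion> z"
    unfolding e using c by (simp add: join_le)
  show "(x \<sqinter> y) \<squnion> z \<sqsubseteq> (x \<squnion> z) \<sqinter> (y \<squnion> z)" using c
    by (simp add: meet_le join_mono meet_left meet_right)
qed (use c in auto)

end

lemma gba_I:
  fixes L :: "'a gorder"
  assumes eq: "eq L = (=)"
    and refl: "\<And>x. x \<in> carrier L \<Longrightarrow> x \<sqsubseteq>\<^bsub>L\<^esub> x"
    and antisym: "\<And>x y. \<lbrakk>x \<sqsubseteq>\<^bsub>L\<^esub> y; y \<sqsubseteq>\<^bsub>L\<^esub> x; x \<in> carrier L; y \<in> carrier L\<rbrakk> \<Longrightarrow> x = y"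
    and trans: "\<And>x y z. \<lbrakk>x \<sqsubseteq>\<^bsub>L\<^esub> y; y \<sqsubseteq>\<^bsub>L\<^esub> z; x \<in> carrier L; y \<in> carrier L; z \<in> carrier L\<rbrakk>
       \<Longrightarrow> x \<sqsubseteq>\<^bsub>L\<^esub> z"
    and j: "\<And>x y. \<lbrakk>x \<in> carrier L; y \<in> carrier L\<rbrakk> \<Longrightarrow> j x y \<in> carrier L \<and> x \<sqsubseteq>\<^bsub>L\<^esub> j x y \<and>
       y \<sqsubseteq>\<^bsub>L\<^esub> j x y"
    and j': "\<And>x y z. \<lbrakk>x \<in> carrier L; y \<in> carrier L; z \<in> carrier L; x \<sqsubseteq>\<^bsub>L\<^esub> z; y \<sqsubseteq>\<^bsub>L\<^esub> z\<rbrakk>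
       \<Longrightarrow> j x y \<sqsubseteq>\<^bsub>L\<^esub> z"
    and m: "\<And>x y. \<lbrakk>x \<in> carrier L; y \<in> carrier L\<rbrakk> \<Longrightarrow> m x y \<in> carrier L \<and> m x y \<sqsubseteq>\<^bsub>L\<^esub> x \<and>
       m x y \<sqsubseteq>\<^bsub>L\<^esub> y"
    and m': "\<And>x y z. \<lbrakk>x \<in> carrier L; y \<in> carrier L; z \<in> carrier L; z \<sqsubseteq>\<^bsub>L\<^esub> x; z \<sqsubseteq>\<^bsub>L\<^esub> y\<rbrakk>
       \<Longrightarrow> z \<sqsubseteq>\<^bsub>L\<^esub> m x y"
    and z: "z \<in> carrier L" "\<And>x. x \<in> carrier L \<Longrightarrow> z \<sqsubseteq>\<^bsub>L\<^esub> x"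
    and distr: "\<And>x y w. \<lbrakk>x \<in> carrier L; y \<in> carrier L; w \<in> carrier L\<rbrakk>
       \<Longrightarrow> m x (j y w) = j (m x y) (m x w)"
    and d: "\<And>x y. \<lbrakk>x \<in> carrier L; y \<in> carrier L\<rbrakk>
       \<Longrightarrow> d x y \<in> carrier L \<and> m (d x y) y = z \<and> j (d x y) (m x y) = x"
  shows "generalized_boolean_algebra L \<and> \<bottom>\<^bsub>L\<^esub> = z \<and>
    (\<forall>x\<in>carrier L. \<forall>y\<in>carrier L.
       x \<squnion>\<^bsub>L\<^esub> y = j x y \<and> x \<sqinter>\<^bsub>L\<^esub> y = m x y \<and> rel_compl L x y = d x y)"
proof -
  have po: "partial_order L"
    by unfold_locales (simp_all add: eq refl antisym, rule trans)
  interpret partial_order L by (rule po)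
  have lub: "least L (j x y) (Upper L {x, y})" if "x \<in> carrier L" "y \<in> carrier L" for x y
    using j[OF that] j'[OF that] that by (intro least_UpperI) (auto simp: Upper_def)
  have glb: "greatest L (m x y) (Lower L {x, y})" if "x \<in> carrier L" "y \<in> carrier L" for x y
    using m[OF that] m'[OF that] that by (intro greatest_LowerI) (auto simp: Lower_def)
  have lat: "lattice L"
    by unfold_locales (use lub glb in blast)+
  interpret lattice L by (rule lat)
  have J: "x \<squnion>\<^bsub>L\<^esub> y = j x y" if "x \<in> carrier L" "y \<in> carrier L" for x y
    using joinI[of x y "\<lambda>t. t = j x y"] lub[OF that] that least_unique by blast
  have M: "x \<sqinter>\<^bsub>L\<^esub> y = m x y" if "x \<in> carrier L" "y \<in> carrier L" for x y
    using meetI[of x y "\<lambda>t. t = m x y"] glb[OF that] that greatest_unique by blast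
  have least: "least L z (carrier L)" using z by (simp add: least_def)
  interpret weak_partial_order_bottom L by unfold_locales (use least in blast)
  have Z: "\<bottom>\<^bsub>L\<^esub> = z" using least bottom_least least_unique by blast
  have gba: "generalized_boolean_algebra L"
  proof unfold_locales
    fix x y w assume "x \<in> carrier L" "y \<in> carrier L" "w \<in> carrier L"
    then show "x \<sqinter>\<^bsub>L\<^esub> (y \<squnion>\<^bsub>L\<^esub> w) = x \<sqinter>\<^bsub>L\<^esub> y \<squnion>\<^bsub>L\<^esub> x \<sqinter>\<^bsub>L\<^esub> w"
      using distr[of x y w] by (simp add: J M j m)
  next
    fix x y assume "x \<in> carrier L" "y \<in> carrier L"
    then show "\<exists>d\<in>carrier L. d \<sqinter>\<^bsub>L\<^esub> y = \<bottom>\<^bsub>L\<^esub> \<and> d \<squnion>\<^bsub>L\<^esub> x \<sqinter>\<^bsub>L\<^esub> y = x"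
      using d[of x y] by (intro bexI[of _ "d x y"]) (simp_all add: J M m Z)
  qed
  have R: "rel_compl L x y = d x y" if "x \<in> carrier L" "y \<in> carrier L" for x y
    using d[OF that] that
    by (intro generalized_boolean_algebra.rel_compl_eqI[OF gba]) (simp_all add: J M m Z)
  show ?thesis using gba J M Z R by blast
qed

lemma gba_morphismI:
  assumes B: "generalized_boolean_algebra B" and C: "generalized_boolean_algebra C"
    and f: "f \<in> carrier B \<rightarrow> carrier C" "f \<bottom>\<^bsub>B\<^esub> = \<bottom>\<^bsub>C\<^esub>"
    and j: "\<And>x y. \<lbrakk>x \<in> carrier B; y \<in> carrier B\<rbrakk> \<Longrightarrow> f (x \<squnion>\<^bsub>B\<^esub> y) = f x \<squnion>\<^bsub>C\<^esub> f y"
    and m: "\<And>x y. \<lbrakk>x \<in> carrier B; y \<in> carrier B\<rbrakk> \<Longrightarrow> f (x \<sqinter>\<^bsub>B\<^esub> y) = f x \<sqinter>\<^bsub>C\<^esub> f y"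
  shows "gba_morphism B C f"
proof -
  interpret B: generalized_boolean_algebra B by (rule B)
  interpret C: generalized_boolean_algebra C by (rule C)
  have "f (rel_compl B x y) = rel_compl C (f x) (f y)" if "x \<in> carrier B" "y \<in> carrier B" for x y
    using B.rel_compl_props[OF that] that f
    by (intro C.rel_compl_eqI[symmetric]) (auto simp flip: j m)
  then show ?thesis
    using f j m B.lattice_axioms C.lattice_axioms
    by (simp add: gba_morphism_def join_pres_def meet_pres_def)
qed

subsection \<open>Quotients by ideals\<close>

context generalized_boolean_algebra
begin

lemma le_mod_iff:
  assumes K: "gba_ideal B K" and c: "x \<in> carrier B" "y \<in> carrier B"
  shows "(\<exists>u\<in>K. x \<squnion> u = y \<squnion> u) \<longleftrightarrow> (\<exists>u\<in>K. x \<sqsubseteq> y \<squnion> u) \<and> (\<exists>u\<in>K. y \<sqsubseteq> x \<squnion> u)"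
proof
  assume "\<exists>u\<in>K. x \<squnion> u = y \<squnion> u"
  then show "(\<exists>u\<in>K. x \<sqsubseteq> y \<squnion> u) \<and> (\<exists>u\<in>K. y \<sqsubseteq> x \<squnion> u)"
    using K c unfolding gba_ideal_def by (metis join_left subsetD)
next
  assume "(\<exists>u\<in>K. x \<sqsubseteq> y \<squnion> u) \<and> (\<exists>u\<in>K. y \<sqsubseteq> x \<squnion> u)"
  then obtain u v where uv: "u \<in> K" "v \<in> K" "x \<sqsubseteq> y \<squnion> u" "y \<sqsubseteq> x \<squnion> v" by blast
  then have c': "u \<in> carrier B" "v \<in> carrier B" "u \<squnion> v \<in> K"
    using K unfolding gba_ideal_def by auto
  have w: "u \<sqsubseteq> z \<squnion> (u \<squnion> v)" "v \<sqsubseteq> z \<squnion> (u \<squnion> v)" if "z \<in> carrier B" for z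
    using that c' by (meson join_closed join_left join_right le_trans)+
  have "x \<squnion> (u \<squnion> v) \<sqsubseteq> y \<squnion> (u \<squnion> v)" using c c' w
    by (intro join_le le_trans[OF uv(3)]) (auto simp: join_left)
  moreover have "y \<squnion> (u \<squnion> v) \<sqsubseteq> x \<squnion> (u \<squnion> v)" using c c' w
    by (intro join_le le_trans[OF uv(4)]) (auto simp: join_left)
  ultimately have "x \<squnion> (u \<squnion> v) = y \<squnion> (u \<squnion> v)" using c c' by (intro le_antisym) auto
  then show "\<exists>u\<in>K. x \<squnion> u = y \<squnion> u" using c' by blast
qed

lemma le_mod_trans:
  assumes K: "gba_ideal B K" and "\<exists>u\<in>K. x \<sqsubseteq> y \<squnion> u" "\<exists>u\<in>K. y \<sqsubseteq> z \<squnion> u"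
    and c: "x \<in> carrier B" "y \<in> carrier B" "z \<in> carrier B"
  shows "\<exists>u\<in>K. x \<sqsubseteq> z \<squnion> u"
proof -
  obtain u v where uv: "u \<in> K" "v \<in> K" "x \<sqsubseteq> y \<squnion> u" "y \<sqsubseteq> z \<squnion> v" using assms by blast
  then have c': "u \<in> carrier B" "v \<in> carrier B" "v \<squnion> u \<in> K"
    using K unfolding gba_ideal_def by auto
  have "y \<squnion> u \<sqsubseteq> z \<squnion> (v \<squnion> u)" using c c'
    by (intro join_le le_trans[OF uv(4)] join_mono)
      (auto intro: le_trans[OF join_right[of v u] join_right[of z]] simp: join_left)
  then have "x \<sqsubseteq> z \<squnion> (v \<squnion> u)" using c c' uv(3) by (meson join_closed le_trans)
  then show ?thesis using c' by blast
qed

lemma le_mod_of_le: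
  assumes K: "gba_ideal B K" and "x \<sqsubseteq> y" "x \<in> carrier B" "y \<in> carrier B"
  shows "\<exists>u\<in>K. x \<sqsubseteq> y \<squnion> u"
proof -
  obtain u where "u \<in> K" "u \<in> carrier B" using K unfolding gba_ideal_def by blast
  then show ?thesis using assms by (meson join_closed join_left le_trans)
qed

lemma le_mod_two:
  assumes K: "gba_ideal B K" and "\<exists>u\<in>K. x \<sqsubseteq> y \<squnion> u" "\<exists>u\<in>K. x' \<sqsubseteq> y' \<squnion> u"
    and c: "x \<in> carrier B" "y \<in> carrier B" "x' \<in> carrier B" "y' \<in> carrier B"
  obtains w where "w \<in> K" "w \<in> carrier B" "x \<sqsubseteq> y \<squnion> w" "x' \<sqsubseteq> y' \<squnion> w"
proof -
  obtain u v where uv: "u \<in> K" "v \<in> K" "x \<sqsubseteq> y \<squnion> u" "x' \<sqsubseteq> y' \<squnion> v" using assms by blast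
  then have c': "u \<in> carrier B" "v \<in> carrier B" "u \<squnion> v \<in> K"
    using K unfolding gba_ideal_def by auto
  have "x \<sqsubseteq> y \<squnion> (u \<squnion> v)" "x' \<sqsubseteq> y' \<squnion> (u \<squnion> v)" using c c'
    by (auto intro!: le_trans[OF uv(3)] le_trans[OF uv(4)] join_mono simp: join_left join_right)
  then show ?thesis using that c' by simp
qed

lemma le_mod_join:
  assumes K: "gba_ideal B K" and "\<exists>u\<in>K. x \<sqsubseteq> z \<squnion> u" "\<exists>u\<in>K. y \<sqsubseteq> z \<squnion> u"
    and c: "x \<in> carrier B" "y \<in> carrier B" "z \<in> carrier B"
  shows "\<exists>u\<in>K. x \<squnion> y \<sqsubseteq> z \<squnion> u"
  using le_mod_two[OF K assms(2,3)] c by (metis join_closed join_le)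

lemma le_mod_meet:
  assumes K: "gba_ideal B K" and "\<exists>u\<in>K. z \<sqsubseteq> x \<squnion> u" "\<exists>u\<in>K. z \<sqsubseteq> y \<squnion> u"
    and c: "x \<in> carrier B" "y \<in> carrier B" "z \<in> carrier B"
  shows "\<exists>u\<in>K. z \<sqsubseteq> (x \<sqinter> y) \<squnion> u"
proof -
  obtain w where w: "w \<in> K" "w \<in> carrier B" "z \<sqsubseteq> x \<squnion> w" "z \<sqsubseteq> y \<squnion> w"
    using le_mod_two[OF K assms(2,3)] c by metis
  then have "z \<sqsubseteq> (x \<squnion> w) \<sqinter> (y \<squnion> w)" using c by (intro meet_le) auto
  then show ?thesis using w c by (auto simp: distributive_dual)
qed

lemma ideal_rel_iff:
  assumes "gba_ideal B K"
  shows "(x, y) \<in> ideal_rel B K \<longleftrightarrow> x \<in> carrier B \<and> y \<in> carrier B \<and>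
     (\<exists>u\<in>K. x \<sqsubseteq> y \<squnion> u) \<and> (\<exists>u\<in>K. y \<sqsubseteq> x \<squnion> u)"
  using le_mod_iff[OF assms] unfolding ideal_rel_def by blast

lemma equiv_ideal_rel:
  assumes K: "gba_ideal B K"
  shows "equiv (carrier B) (ideal_rel B K)"
proof (rule equivI)
  show "ideal_rel B K \<subseteq> carrier B \<times> carrier B" by (auto simp: ideal_rel_def)
  show "refl_on (carrier B) (ideal_rel B K)"
    using K by (auto simp: ideal_rel_def refl_on_def gba_ideal_def)
  show "sym (ideal_rel B K)" by (rule symI) (auto simp: ideal_rel_iff[OF K])
  show "trans (ideal_rel B K)"
  proof (rule transI)
    fix x y z assume "(x, y) \<in> ideal_rel B K" "(y, z) \<in> ideal_rel B K"
    then have r: "x \<in> carrier B" "y \<in> carrier B" "z \<in> carrier B"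
      "\<exists>u\<in>K. x \<sqsubseteq> y \<squnion> u" "\<exists>u\<in>K. y \<sqsubseteq> x \<squnion> u" "\<exists>u\<in>K. y \<sqsubseteq> z \<squnion> u" "\<exists>u\<in>K. z \<sqsubseteq> y \<squnion> u"
      by (simp_all add: ideal_rel_iff[OF K])
    show "(x, z) \<in> ideal_rel B K"
      unfolding ideal_rel_iff[OF K]
      using r(1,3) le_mod_trans[OF K r(4,6,1,2,3)] le_mod_trans[OF K r(7,5,3,2,1)] by blast
  qed
qed

lemma ideal_class_closed:
  "x \<in> carrier B \<Longrightarrow> ideal_class B K x \<in> carrier (quotient_algebra B K)"
  by (simp add: quotient_algebra_def ideal_class_def quotientI)

lemma ideal_class_cases:
  assumes "C \<in> carrier (quotient_algebra B K)"
  obtains x where "x \<in> carrier B" "C = ideal_class B K x"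
  using assms by (auto simp: quotient_algebra_def ideal_class_def elim: quotientE)

lemma ideal_class_le:
  assumes K: "gba_ideal B K" and c: "x \<in> carrier B" "y \<in> carrier B"
  shows "ideal_class B K x \<sqsubseteq>\<^bsub>quotient_algebra B K\<^esub> ideal_class B K y \<longleftrightarrow> (\<exists>u\<in>K. x \<sqsubseteq> y \<squnion> u)"
proof
  assume "ideal_class B K x \<sqsubseteq>\<^bsub>quotient_algebra B K\<^esub> ideal_class B K y"
  then obtain x' y' where r: "(x, x') \<in> ideal_rel B K" "(y, y') \<in> ideal_rel B K" "x' \<sqsubseteq> y'"
    by (auto simp: quotient_algebra_def ideal_class_def)
  then have c': "x' \<in> carrier B" "y' \<in> carrier B" by (auto simp: ideal_rel_def)
  have xx: "\<exists>u\<in>K. x \<sqsubseteq> x' \<squnion> u" and yy: "\<exists>u\<in>K. y' \<sqsubseteq> y \<squnion> u"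
    using r(1,2) by (simp_all add: ideal_rel_iff[OF K])
  have "\<exists>u\<in>K. x \<sqsubseteq> y' \<squnion> u"
    by (rule le_mod_trans[OF K xx le_mod_of_le[OF K r(3) c'] c(1) c'])
  then show "\<exists>u\<in>K. x \<sqsubseteq> y \<squnion> u"
    by (rule le_mod_trans[OF K _ yy c(1) c'(2) c(2)])
next
  assume "\<exists>u\<in>K. x \<sqsubseteq> y \<squnion> u"
  then obtain u where u: "u \<in> K" "u \<in> carrier B" "x \<sqsubseteq> y \<squnion> u"
    using K unfolding gba_ideal_def by blast
  have "(x, x) \<in> ideal_rel B K" using equiv_ideal_rel[OF K] c by (auto simp: equiv_def refl_on_def)
  moreover have "\<exists>v\<in>K. y \<squnion> u \<sqsubseteq> y \<squnion> v" using u c by (intro bexI[of _ u]) auto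
  then have "(y, y \<squnion> u) \<in> ideal_rel B K"
    using u c le_mod_of_le[OF K, of y "y \<squnion> u"] by (simp add: ideal_rel_iff[OF K] join_left)
  ultimately show "ideal_class B K x \<sqsubseteq>\<^bsub>quotient_algebra B K\<^esub> ideal_class B K y"
    using u by (auto simp: quotient_algebra_def ideal_class_def)
qed

lemma ideal_class_eq:
  assumes K: "gba_ideal B K" and c: "x \<in> carrier B" "y \<in> carrier B"
  shows "ideal_class B K x = ideal_class B K y \<longleftrightarrow>
    (\<exists>u\<in>K. x \<sqsubseteq> y \<squnion> u) \<and> (\<exists>u\<in>K. y \<sqsubseteq> x \<squnion> u)"
  using eq_equiv_class_iff[OF equiv_ideal_rel[OF K] c] c
  by (simp add: ideal_class_def ideal_rel_iff[OF K])

lemma ideal_class_cong: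
  assumes K: "gba_ideal B K"
    and c: "x \<in> carrier B" "x' \<in> carrier B" "y \<in> carrier B" "y' \<in> carrier B"
    and e: "ideal_class B K x = ideal_class B K x'" "ideal_class B K y = ideal_class B K y'"
  shows "ideal_class B K (x \<squnion> y) = ideal_class B K (x' \<squnion> y')"
    and "ideal_class B K (x \<sqinter> y) = ideal_class B K (x' \<sqinter> y')"
proof -
  have *: "(\<exists>u\<in>K. p \<squnion> q \<sqsubseteq> (p' \<squnion> q') \<squnion> u) \<and> (\<exists>u\<in>K. p \<sqinter> q \<sqsubseteq> (p' \<sqinter> q') \<squnion> u)"
    if "p \<in> carrier B" "p' \<in> carrier B" "q \<in> carrier B" "q' \<in> carrier B"
      "\<exists>u\<in>K. p \<sqsubseteq> p' \<squnion> u" "\<exists>u\<in>K. q \<sqsubseteq> q' \<squnion> u" for p p' q q'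
  proof -
    note mt = le_mod_trans[OF K] and ml = le_mod_of_le[OF K]
    have "\<exists>u\<in>K. p \<sqsubseteq> (p' \<squnion> q') \<squnion> u"
      by (rule mt[OF that(5) ml]) (use that(1-4) in \<open>simp_all add: join_left\<close>)
    moreover have "\<exists>u\<in>K. q \<sqsubseteq> (p' \<squnion> q') \<squnion> u"
      by (rule mt[OF that(6) ml]) (use that(1-4) in \<open>simp_all add: join_right\<close>)
    moreover have "\<exists>u\<in>K. p \<sqinter> q \<sqsubseteq> p' \<squnion> u"
      by (rule mt[OF ml that(5)]) (use that(1-4) in \<open>simp_all add: meet_left\<close>)
    moreover have "\<exists>u\<in>K. p \<sqinter> q \<sqsubseteq> q' \<squnion> u"
      by (rule mt[OF ml that(6)]) (use that(1-4) in \<open>simp_all add: meet_right\<close>)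
    ultimately show ?thesis
      using that by (simp add: le_mod_join[OF K] le_mod_meet[OF K])
  qed
  show "ideal_class B K (x \<squnion> y) = ideal_class B K (x' \<squnion> y')"
    "ideal_class B K (x \<sqinter> y) = ideal_class B K (x' \<sqinter> y')"
    using e c *[of x x' y y'] *[of x' x y' y] by (simp_all add: ideal_class_eq[OF K])
qed

lemma
  assumes K: "gba_ideal B K"
  shows quotient_gba: "generalized_boolean_algebra (quotient_algebra B K)"
    and ideal_class_operations:
      "ideal_class B K \<bottom> = \<bottom>\<^bsub>quotient_algebra B K\<^esub>"
      "\<And>x y. \<lbrakk>x \<in> carrier B; y \<in> carrier B\<rbrakk> \<Longrightarrow>
         ideal_class B K (x \<squnion> y) =
           ideal_class B K x \<squnion>\<^bsub>quotient_algebra B K\<^esub> ideal_class B K y"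
      "\<And>x y. \<lbrakk>x \<in> carrier B; y \<in> carrier B\<rbrakk> \<Longrightarrow>
         ideal_class B K (x \<sqinter> y) =
           ideal_class B K x \<sqinter>\<^bsub>quotient_algebra B K\<^esub> ideal_class B K y"
      "\<And>x y. \<lbrakk>x \<in> carrier B; y \<in> carrier B\<rbrakk> \<Longrightarrow>
         ideal_class B K (rel_compl B x y) =
           rel_compl (quotient_algebra B K) (ideal_class B K x) (ideal_class B K y)"
proof -
  let ?Q = "quotient_algebra B K" and ?c = "ideal_class B K"
  define r where "r C = (SOME x. x \<in> carrier B \<and> C = ?c x)" for C
  have "r C \<in> carrier B \<and> C = ?c (r C)" if "C \<in> carrier ?Q" for C
    unfolding r_def by (rule someI_ex) (use that ideal_class_cases in blast)
  then have r: "r C \<in> carrier B" "?c (r C) = C" if "C \<in> carrier ?Q" for C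
    using that by auto
  let ?j = "\<lambda>C D. ?c (r C \<squnion> r D)" and ?m = "\<lambda>C D. ?c (r C \<sqinter> r D)"
  let ?d = "\<lambda>C D. ?c (rel_compl B (r C) (r D))"
  note [simp] = r ideal_class_closed rel_compl_props
  have j: "?j (?c x) (?c y) = ?c (x \<squnion> y)" and m: "?m (?c x) (?c y) = ?c (x \<sqinter> y)"
    if "x \<in> carrier B" "y \<in> carrier B" for x y
    using that by (intro ideal_class_cong[OF K]; simp)+
  have le: "C \<sqsubseteq>\<^bsub>?Q\<^esub> D \<longleftrightarrow> (\<exists>u\<in>K. r C \<sqsubseteq> r D \<squnion> u)" if "C \<in> carrier ?Q" "D \<in> carrier ?Q" for C D
    using that ideal_class_le[OF K, of "r C" "r D"] by simp
  have le1: "C \<sqsubseteq>\<^bsub>?Q\<^esub> ?c x \<longleftrightarrow> (\<exists>u\<in>K. r C \<sqsubseteq> x \<squnion> u)" if "C \<in> carrier ?Q" "x \<in> carrier B" for C x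
    using that ideal_class_le[OF K, of "r C" "x"] by simp
  have le2: "?c x \<sqsubseteq>\<^bsub>?Q\<^esub> C \<longleftrightarrow> (\<exists>u\<in>K. x \<sqsubseteq> r C \<squnion> u)" if "C \<in> carrier ?Q" "x \<in> carrier B" for C x
    using that ideal_class_le[OF K, of x "r C"] by simp
  have a1: "eq ?Q = (=)" by (simp add: quotient_algebra_def)
  have a2: "C \<sqsubseteq>\<^bsub>?Q\<^esub> C" if "C \<in> carrier ?Q" for C
    using that le_mod_of_le[OF K] by (simp add: le)
  have a3: "C = D" if "C \<sqsubseteq>\<^bsub>?Q\<^esub> D" "D \<sqsubseteq>\<^bsub>?Q\<^esub> C" "C \<in> carrier ?Q" "D \<in> carrier ?Q" for C D
    using that ideal_class_eq[OF K, of "r C" "r D"] by (simp add: le)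
  have a4: "C \<sqsubseteq>\<^bsub>?Q\<^esub> E" if "C \<sqsubseteq>\<^bsub>?Q\<^esub> D" "D \<sqsubseteq>\<^bsub>?Q\<^esub> E" "C \<in> carrier ?Q" "D \<in> carrier ?Q" "E \<in> carrier ?Q"
    for C D E
    using that le_mod_trans[OF K, of "r C" "r D" "r E"] by (simp add: le)
  have a5: "?j C D \<in> carrier ?Q \<and> C \<sqsubseteq>\<^bsub>?Q\<^esub> ?j C D \<and> D \<sqsubseteq>\<^bsub>?Q\<^esub> ?j C D"
    if "C \<in> carrier ?Q" "D \<in> carrier ?Q" for C D
    using that by (simp add: le1 le_mod_of_le[OF K] join_left join_right)
  have a6: "?j C D \<sqsubseteq>\<^bsub>?Q\<^esub> E"
    if "C \<in> carrier ?Q" "D \<in> carrier ?Q" "E \<in> carrier ?Q" "C \<sqsubseteq>\<^bsub>?Q\<^esub> E" "D \<sqsubseteq>\<^bsub>?Q\<^esub> E" for C D E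
    unfolding le2[OF that(3) join_closed[OF r(1)[OF that(1)] r(1)[OF that(2)]]]
    using that by (intro le_mod_join[OF K]) (simp_all add: le)
  have a7: "?m C D \<in> carrier ?Q \<and> ?m C D \<sqsubseteq>\<^bsub>?Q\<^esub> C \<and> ?m C D \<sqsubseteq>\<^bsub>?Q\<^esub> D"
    if "C \<in> carrier ?Q" "D \<in> carrier ?Q" for C D
    using that by (simp add: le2 le_mod_of_le[OF K] meet_left meet_right)
  have a8: "E \<sqsubseteq>\<^bsub>?Q\<^esub> ?m C D"
    if "C \<in> carrier ?Q" "D \<in> carrier ?Q" "E \<in> carrier ?Q" "E \<sqsubseteq>\<^bsub>?Q\<^esub> C" "E \<sqsubseteq>\<^bsub>?Q\<^esub> D" for C D E
    unfolding le1[OF that(3) meet_closed[OF r(1)[OF that(1)] r(1)[OF that(2)]]]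
    using that by (intro le_mod_meet[OF K]) (simp_all add: le)
  have a9: "?c \<bottom> \<in> carrier ?Q" by simp
  have a10: "?c \<bottom> \<sqsubseteq>\<^bsub>?Q\<^esub> C" if "C \<in> carrier ?Q" for C
    using that by (simp add: le2 le_mod_of_le[OF K])
  have a11: "?m C (?j D E) = ?j (?m C D) (?m C E)"
    if "C \<in> carrier ?Q" "D \<in> carrier ?Q" "E \<in> carrier ?Q" for C D E
    using that m[of "r C" "r D \<squnion> r E"] j[of "r C \<sqinter> r D" "r C \<sqinter> r E"] by (simp add: distributive)
  have a12: "?d C D \<in> carrier ?Q \<and> ?m (?d C D) D = ?c \<bottom> \<and> ?j (?d C D) (?m C D) = C"
    if "C \<in> carrier ?Q" "D \<in> carrier ?Q" for C D
    using that m[of "rel_compl B (r C) (r D)" "r D"] j[of "rel_compl B (r C) (r D)" "r C \<sqinter> r D"]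
    by simp
  have g: "generalized_boolean_algebra ?Q \<and> \<bottom>\<^bsub>?Q\<^esub> = (?c \<bottom>) \<and>
    (\<forall>x\<in>carrier ?Q. \<forall>y\<in>carrier ?Q.
       x \<squnion>\<^bsub>?Q\<^esub> y = ?j x y \<and> x \<sqinter>\<^bsub>?Q\<^esub> y = ?m x y \<and> rel_compl ?Q x y = ?d x y)"
    by (rule gba_I) (fact a1 a2 a3 a4 a5 a6 a7 a8 a9 a10 a11 a12)+
  show gba: "generalized_boolean_algebra ?Q" using g by blast
  show b: "?c \<bottom> = \<bottom>\<^bsub>?Q\<^esub>" using g by simp
  show J: "?c (x \<squnion> y) = ?c x \<squnion>\<^bsub>?Q\<^esub> ?c y" if "x \<in> carrier B" "y \<in> carrier B" for x y
    using g j[OF that] that by simp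
  show M: "?c (x \<sqinter> y) = ?c x \<sqinter>\<^bsub>?Q\<^esub> ?c y" if "x \<in> carrier B" "y \<in> carrier B" for x y
    using g m[OF that] that by simp
  show "?c (rel_compl B x y) = rel_compl ?Q (?c x) (?c y)" if "x \<in> carrier B" "y \<in> carrier B" for x y
    by (rule generalized_boolean_algebra.rel_compl_eqI[OF gba, symmetric])
      (use that rel_compl_props[OF that] in \<open>simp_all flip: b J M\<close>)
qed

end


subsection \<open>Direct sums\<close>

lemma
  assumes "\<forall>i. generalized_boolean_algebra (B i)"
  shows direct_sum_gba: "generalized_boolean_algebra (direct_sum B)"
    and direct_sum_operations:
      "\<bottom>\<^bsub>direct_sum B\<^esub> = (\<lambda>i. \<bottom>\<^bsub>B i\<^esub>)"
      "\<And>f g. \<lbrakk>f \<in> carrier (direct_sum B); g \<in> carrier (direct_sum B)\<rbrakk>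
         \<Longrightarrow> f \<squnion>\<^bsub>direct_sum B\<^esub> g = (\<lambda>i. f i \<squnion>\<^bsub>B i\<^esub> g i)"
      "\<And>f g. \<lbrakk>f \<in> carrier (direct_sum B); g \<in> carrier (direct_sum B)\<rbrakk>
         \<Longrightarrow> f \<sqinter>\<^bsub>direct_sum B\<^esub> g = (\<lambda>i. f i \<sqinter>\<^bsub>B i\<^esub> g i)"
      "\<And>f g. \<lbrakk>f \<in> carrier (direct_sum B); g \<in> carrier (direct_sum B)\<rbrakk>
         \<Longrightarrow> rel_compl (direct_sum B) f g = (\<lambda>i. rel_compl (B i) (f i) (g i))"
proof -
  interpret B: generalized_boolean_algebra "B i" for i using assms by blast
  let ?D = "direct_sum B"
  have C: "f \<in> carrier ?D \<longleftrightarrow> (\<forall>i. f i \<in> carrier (B i)) \<and> finite {i. f i \<noteq> \<bottom>\<^bsub>B i\<^esub>}" for f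
    by (simp add: direct_sum_def)
  have L: "f \<sqsubseteq>\<^bsub>?D\<^esub> g \<longleftrightarrow> (\<forall>i. f i \<sqsubseteq>\<^bsub>B i\<^esub> g i)" for f g
    by (simp add: direct_sum_def)
  have fin: "(\<lambda>i. h i (f i) (g i)) \<in> carrier ?D"
    if "f \<in> carrier ?D" "g \<in> carrier ?D"
      and "\<And>i x y. \<lbrakk>x \<in> carrier (B i); y \<in> carrier (B i)\<rbrakk> \<Longrightarrow> h i x y \<in> carrier (B i)"
      and "\<And>i. h i \<bottom>\<^bsub>B i\<^esub> \<bottom>\<^bsub>B i\<^esub> = \<bottom>\<^bsub>B i\<^esub>" for f g h
  proof -
    have "{i. h i (f i) (g i) \<noteq> \<bottom>\<^bsub>B i\<^esub>} \<subseteq> {i. f i \<noteq> \<bottom>\<^bsub>B i\<^esub>} \<union> {i. g i \<noteq> \<bottom>\<^bsub>B i\<^esub>}"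
      using that(4) by auto
    then have "finite {i. h i (f i) (g i) \<noteq> \<bottom>\<^bsub>B i\<^esub>}"
      by (rule finite_subset) (use that(1,2) in \<open>simp add: C\<close>)
    then show ?thesis using that by (simp add: C)
  qed
  have rc: "rel_compl (B i) \<bottom>\<^bsub>B i\<^esub> \<bottom>\<^bsub>B i\<^esub> = \<bottom>\<^bsub>B i\<^esub>" for i
    by (rule B.rel_compl_eqI) (auto simp: B.meet_bottom B.join_bottom)
  let ?j = "\<lambda>f g i. f i \<squnion>\<^bsub>B i\<^esub> g i" and ?m = "\<lambda>f g i. f i \<sqinter>\<^bsub>B i\<^esub> g i"
  let ?d = "\<lambda>f g i. rel_compl (B i) (f i) (g i)"
  have c: "?j f g \<in> carrier ?D" "?m f g \<in> carrier ?D" "?d f g \<in> carrier ?D"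
    if "f \<in> carrier ?D" "g \<in> carrier ?D" for f g
    using that
      fin[OF that, of "\<lambda>i. join (B i)"] fin[OF that, of "\<lambda>i. meet (B i)"]
      fin[OF that, of "\<lambda>i. rel_compl (B i)"]
    by (simp_all add: B.meet_bottom B.join_bottom B.rel_compl_props rc)
  have z: "(\<lambda>i. \<bottom>\<^bsub>B i\<^esub>) \<in> carrier ?D" by (simp add: C)
  have cc: "f i \<in> carrier (B i)" if "f \<in> carrier ?D" for f i using that C by blast
  have a1: "eq ?D = (=)" by (simp add: direct_sum_def)
  have a2: "f \<sqsubseteq>\<^bsub>?D\<^esub> f" if "f \<in> carrier ?D" for f using that by (simp add: L cc)
  have a3: "f = g" if "f \<sqsubseteq>\<^bsub>?D\<^esub> g" "g \<sqsubseteq>\<^bsub>?D\<^esub> f" "f \<in> carrier ?D" "g \<in> carrier ?D" for f g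
    using that by (auto simp: L intro!: B.le_antisym cc)
  have a4: "f \<sqsubseteq>\<^bsub>?D\<^esub> h"
    if "f \<sqsubseteq>\<^bsub>?D\<^esub> g" "g \<sqsubseteq>\<^bsub>?D\<^esub> h" "f \<in> carrier ?D" "g \<in> carrier ?D" "h \<in> carrier ?D" for f g h
    using that unfolding L by (blast intro: B.le_trans cc)
  have a5: "?j f g \<in> carrier ?D \<and> f \<sqsubseteq>\<^bsub>?D\<^esub> ?j f g \<and> g \<sqsubseteq>\<^bsub>?D\<^esub> ?j f g"
    if "f \<in> carrier ?D" "g \<in> carrier ?D" for f g
    using that c by (simp add: L cc B.join_left B.join_right)
  have a6: "?j f g \<sqsubseteq>\<^bsub>?D\<^esub> h"
    if "f \<in> carrier ?D" "g \<in> carrier ?D" "h \<in> carrier ?D" "f \<sqsubseteq>\<^bsub>?D\<^esub> h" "g \<sqsubseteq>\<^bsub>?D\<^esub> h" for f g h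
    using that by (simp add: L cc B.join_le)
  have a7: "?m f g \<in> carrier ?D \<and> ?m f g \<sqsubseteq>\<^bsub>?D\<^esub> f \<and> ?m f g \<sqsubseteq>\<^bsub>?D\<^esub> g"
    if "f \<in> carrier ?D" "g \<in> carrier ?D" for f g
    using that c by (simp add: L cc B.meet_left B.meet_right)
  have a8: "h \<sqsubseteq>\<^bsub>?D\<^esub> ?m f g"
    if "f \<in> carrier ?D" "g \<in> carrier ?D" "h \<in> carrier ?D" "h \<sqsubseteq>\<^bsub>?D\<^esub> f" "h \<sqsubseteq>\<^bsub>?D\<^esub> g" for f g h
    using that by (simp add: L cc B.meet_le)
  have a10: "(\<lambda>i. \<bottom>\<^bsub>B i\<^esub>) \<sqsubseteq>\<^bsub>?D\<^esub> f" if "f \<in> carrier ?D" for f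
    using that by (simp add: L cc)
  have a11: "?m f (?j g h) = ?j (?m f g) (?m f h)"
    if "f \<in> carrier ?D" "g \<in> carrier ?D" "h \<in> carrier ?D" for f g h
    using that by (simp add: cc B.distributive)
  have a12: "?d f g \<in> carrier ?D \<and> ?m (?d f g) g = (\<lambda>i. \<bottom>\<^bsub>B i\<^esub>) \<and> ?j (?d f g) (?m f g) = f"
    if "f \<in> carrier ?D" "g \<in> carrier ?D" for f g
    using that c by (simp add: cc B.rel_compl_props)
  have g: "generalized_boolean_algebra ?D \<and> \<bottom>\<^bsub>?D\<^esub> = (\<lambda>i. \<bottom>\<^bsub>B i\<^esub>) \<and>
    (\<forall>x\<in>carrier ?D. \<forall>y\<in>carrier ?D.
       x \<squnion>\<^bsub>?D\<^esub> y = ?j x y \<and> x \<sqinter>\<^bsub>?D\<^esub> y = ?m x y \<and> rel_compl ?D x y = ?d x y)"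
    by (rule gba_I) (fact a1 a2 a3 a4 a5 a6 a7 a8 z a10 a11 a12)+
  show "generalized_boolean_algebra ?D" using g by blast
  show "\<bottom>\<^bsub>?D\<^esub> = (\<lambda>i. \<bottom>\<^bsub>B i\<^esub>)" using g by blast
  fix f g assume "f \<in> carrier ?D" "g \<in> carrier ?D"
  then show "f \<squnion>\<^bsub>?D\<^esub> g = ?j f g" "f \<sqinter>\<^bsub>?D\<^esub> g = ?m f g" "rel_compl ?D f g = ?d f g"
    using g by blast+
qed

lemma coord_closed:
  assumes "\<forall>i. generalized_boolean_algebra (B i)" and "x \<in> carrier (B i)"
  shows "coord B i x \<in> carrier (direct_sum B)"
proof -
  interpret B: generalized_boolean_algebra "B i" for i using assms by blast
  have "{j. coord B i x j \<noteq> \<bottom>\<^bsub>B j\<^esub>} \<subseteq> {i}" by (auto simp: coord_def)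
  then show ?thesis
    using assms(2) by (auto simp: direct_sum_def coord_def intro: finite_subset)
qed

lemma direct_sum_carrierD: "f \<in> carrier (direct_sum B) \<Longrightarrow> f i \<in> carrier (B i)"
  by (simp add: direct_sum_def)

lemma coord_operations:
  assumes B: "\<forall>i. generalized_boolean_algebra (B i)"
    and c: "x \<in> carrier (B i)" "y \<in> carrier (B i)" "f \<in> carrier (direct_sum B)"
  shows "coord B i \<bottom>\<^bsub>B i\<^esub> = \<bottom>\<^bsub>direct_sum B\<^esub>"
    and "coord B i x \<squnion>\<^bsub>direct_sum B\<^esub> coord B i y = coord B i (x \<squnion>\<^bsub>B i\<^esub> y)"
    and "coord B i x \<sqinter>\<^bsub>direct_sum B\<^esub> f = coord B i (x \<sqinter>\<^bsub>B i\<^esub> f i)"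
proof -
  have cx: "coord B i x \<in> carrier (direct_sum B)" by (rule coord_closed[OF B c(1)])
  have cy: "coord B i y \<in> carrier (direct_sum B)" by (rule coord_closed[OF B c(2)])
  interpret B: generalized_boolean_algebra "B k" for k using B by blast
  show "coord B i \<bottom>\<^bsub>B i\<^esub> = \<bottom>\<^bsub>direct_sum B\<^esub>"
    by (auto simp: coord_def direct_sum_operations[OF B])
  show "coord B i x \<squnion>\<^bsub>direct_sum B\<^esub> coord B i y = coord B i (x \<squnion>\<^bsub>B i\<^esub> y)"
    unfolding direct_sum_operations(2)[OF B cx cy]
    by (rule ext) (simp add: coord_def B.join_bottom)
  have "\<bottom>\<^bsub>B j\<^esub> \<sqinter>\<^bsub>B j\<^esub> f j = \<bottom>\<^bsub>B j\<^esub>" for j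
    by (metis B.meet_bottom meet_comm direct_sum_carrierD[OF c(3)])
  then show "coord B i x \<sqinter>\<^bsub>direct_sum B\<^esub> f = coord B i (x \<sqinter>\<^bsub>B i\<^esub> f i)"
    unfolding direct_sum_operations(3)[OF B cx c(3)]
    by (intro ext) (simp add: coord_def)
qed

lemma coord_morphism:
  assumes B: "\<forall>i. generalized_boolean_algebra (B i)" and g: "gba_morphism (B k) (B i) g"
  shows "gba_morphism (direct_sum B) (direct_sum B) (\<lambda>f. coord B i (g (f k)))"
proof (rule gba_morphismI)
  have gc: "g x \<in> carrier (B i)" if "x \<in> carrier (B k)" for x
    using g that by (auto simp: gba_morphism_def)
  show "generalized_boolean_algebra (direct_sum B)" by (rule direct_sum_gba[OF B])
  then show "generalized_boolean_algebra (direct_sum B)" .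
  show "(\<lambda>f. coord B i (g (f k))) \<in> carrier (direct_sum B) \<rightarrow> carrier (direct_sum B)"
    by (auto intro!: coord_closed[OF B] gc intro: direct_sum_carrierD)
  show "coord B i (g (\<bottom>\<^bsub>direct_sum B\<^esub> k)) = \<bottom>\<^bsub>direct_sum B\<^esub>"
    using g by (auto simp: direct_sum_operations[OF B] gba_morphism_def coord_def)
next
  have gc: "g x \<in> carrier (B i)" if "x \<in> carrier (B k)" for x
    using g that by (auto simp: gba_morphism_def)
  fix f f' assume f: "f \<in> carrier (direct_sum B)" "f' \<in> carrier (direct_sum B)"
  then have k: "f k \<in> carrier (B k)" "f' k \<in> carrier (B k)" by (auto simp: direct_sum_carrierD)
  show "coord B i (g ((f \<squnion>\<^bsub>direct_sum B\<^esub> f') k)) =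
      coord B i (g (f k)) \<squnion>\<^bsub>direct_sum B\<^esub> coord B i (g (f' k))"
    using g k by (simp add: direct_sum_operations(2)[OF B f] gba_morphism_def join_pres_def
        coord_operations(2)[OF B gc gc coord_closed[OF B gc]])
  show "coord B i (g ((f \<sqinter>\<^bsub>direct_sum B\<^esub> f') k)) =
      coord B i (g (f k)) \<sqinter>\<^bsub>direct_sum B\<^esub> coord B i (g (f' k))"
    using g k by (simp add: direct_sum_operations(3)[OF B f] gba_morphism_def meet_pres_def
        coord_operations(3)[OF B gc gc coord_closed[OF B gc]])
      (simp add: coord_def)
qed

subsection \<open>The system on the direct sum\<close>

lemma gba_morphism_simps:
  assumes "gba_morphism B C f"
  shows "\<And>x. x \<in> carrier B \<Longrightarrow> f x \<in> carrier C" "f \<bottom>\<^bsub>B\<^esub> = \<bottom>\<^bsub>C\<^esub>"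
    "\<And>x y. \<lbrakk>x \<in> carrier B; y \<in> carrier B\<rbrakk> \<Longrightarrow> f (x \<squnion>\<^bsub>B\<^esub> y) = f x \<squnion>\<^bsub>C\<^esub> f y"
    "\<And>x y. \<lbrakk>x \<in> carrier B; y \<in> carrier B\<rbrakk> \<Longrightarrow> f (x \<sqinter>\<^bsub>B\<^esub> y) = f x \<sqinter>\<^bsub>C\<^esub> f y"
  using assms by (auto simp: gba_morphism_def join_pres_def meet_pres_def)

lemma induced_value:
  assumes B: "generalized_boolean_algebra B" and K: "gba_ideal B K" and M: "gba_ideal B M"
    and h: "gba_morphism B B h" "h ` K \<subseteq> M" and x: "x \<in> carrier B"
  shows "the_elem ((\<lambda>A. ideal_class B M (h A)) ` ideal_class B K x) = ideal_class B M (h x)"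
proof -
  interpret B: generalized_boolean_algebra B by (rule B)
  note h' = gba_morphism_simps[OF h(1)]
  have "ideal_class B M (h y) = ideal_class B M (h x)" if yc: "y \<in> ideal_class B K x" for y
  proof -
    obtain u where u: "u \<in> K" "x \<squnion>\<^bsub>B\<^esub> u = y \<squnion>\<^bsub>B\<^esub> u" and y: "y \<in> carrier B"
      using yc unfolding ideal_class_def ideal_rel_def by blast
    have "u \<in> carrier B" using u K by (auto simp: gba_ideal_def)
    then have "h x \<squnion>\<^bsub>B\<^esub> h u = h y \<squnion>\<^bsub>B\<^esub> h u" using u x y by (simp flip: h'(3))
    then have "\<exists>v\<in>M. h x \<squnion>\<^bsub>B\<^esub> v = h y \<squnion>\<^bsub>B\<^esub> v" using u h by blast
    then show ?thesis
      using B.le_mod_iff[OF M, of "h x" "h y"] B.ideal_class_eq[OF M, of "h y" "h x"] h'(1) x y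
      by blast
  qed
  moreover have "x \<in> ideal_class B K x"
    using K x by (auto simp: ideal_class_def ideal_rel_def gba_ideal_def)
  ultimately have "(\<lambda>A. ideal_class B M (h A)) ` ideal_class B K x = {ideal_class B M (h x)}"
    by blast
  then show ?thesis by simp
qed

lemma induced_morphism:
  assumes B: "generalized_boolean_algebra B" and K: "gba_ideal B K" and M: "gba_ideal B M"
    and h: "gba_morphism B B h" "h ` K \<subseteq> M"
  shows "gba_morphism (quotient_algebra B K) (quotient_algebra B M)
           (\<lambda>C. the_elem ((\<lambda>A. ideal_class B M (h A)) ` C))"
proof (rule gba_morphismI)
  interpret B: generalized_boolean_algebra B by (rule B)
  note h' = gba_morphism_simps[OF h(1)] and v = induced_value[OF B K M h]
    and K' = B.ideal_class_operations[OF K] and M' = B.ideal_class_operations[OF M]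
  let ?g = "\<lambda>C. the_elem ((\<lambda>A. ideal_class B M (h A)) ` C)"
  show "generalized_boolean_algebra (quotient_algebra B K)" by (rule B.quotient_gba[OF K])
  show "generalized_boolean_algebra (quotient_algebra B M)" by (rule B.quotient_gba[OF M])
  show "?g \<in> carrier (quotient_algebra B K) \<rightarrow> carrier (quotient_algebra B M)"
    by (auto elim!: B.ideal_class_cases simp: v intro!: B.ideal_class_closed h'(1))
  show "?g \<bottom>\<^bsub>quotient_algebra B K\<^esub> = \<bottom>\<^bsub>quotient_algebra B M\<^esub>"
    using v[OF B.bottom_closed] by (simp add: h'(2) K'(1) M'(1))
  fix C D assume "C \<in> carrier (quotient_algebra B K)" "D \<in> carrier (quotient_algebra B K)"
  then obtain x y where "x \<in> carrier B" "C = ideal_class B K x" "y \<in> carrier B" "D = ideal_class B K y"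
    by (auto elim!: B.ideal_class_cases)
  then show "?g (C \<squnion>\<^bsub>quotient_algebra B K\<^esub> D) = ?g C \<squnion>\<^bsub>quotient_algebra B M\<^esub> ?g D"
    "?g (C \<sqinter>\<^bsub>quotient_algebra B K\<^esub> D) = ?g C \<sqinter>\<^bsub>quotient_algebra B M\<^esub> ?g D"
    by (simp_all add: v h' M' flip: K')
qed

locale enumerated_gbds =
  fixes S :: "('a, 'l) gbds" and a :: "nat \<Rightarrow> 'l"
  assumes gbds: "generalized_boolean_dynamical_system S"
    and enum: "bij_betw a {1..} (alphabet S)"
begin

sublocale B: generalized_boolean_algebra "algebra S"
  using gbds by (simp add: generalized_boolean_dynamical_system_def)

lemma B: "generalized_boolean_algebra (algebra S)" ..

lemma act_morphism: "\<alpha> \<in> alphabet S \<Longrightarrow> gba_morphism (algebra S) (algebra S) (act S \<alpha>)"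
  using gbds by (simp add: generalized_boolean_dynamical_system_def)

lemmas act_simps = act_morphism[THEN gba_morphism_simps(1)]
  act_morphism[THEN gba_morphism_simps(2)] act_morphism[THEN gba_morphism_simps(3)]
  act_morphism[THEN gba_morphism_simps(4)]

lemma letter: "1 \<le> i \<Longrightarrow> a i \<in> alphabet S"
  using enum by (auto simp: bij_betw_def)

lemma index: "1 \<le> i \<Longrightarrow> inv_into {1..} a (a i) = i"
  using enum by (auto simp: bij_betw_def)

lemma F_ideal_is_ideal: "gba_ideal (algebra S) (F_ideal S a i)"
proof (cases "i = 0")
  case True
  have "\<bottom>\<^bsub>algebra S\<^esub> \<sqinter>\<^bsub>algebra S\<^esub> y = \<bottom>\<^bsub>algebra S\<^esub>" if "y \<in> carrier (algebra S)" for y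
    by (metis that B.meet_bottom meet_comm)
  then show ?thesis using True by (simp add: F_ideal_def gba_ideal_def B.join_bottom)
next
  case False
  let ?J = "{U \<in> carrier (algebra S). has_no_sinks S U \<and> Delta S U \<subseteq> a ` {1..<i}}"
  have bm: "\<bottom>\<^bsub>algebra S\<^esub> \<sqinter>\<^bsub>algebra S\<^esub> y = \<bottom>\<^bsub>algebra S\<^esub>" if "y \<in> carrier (algebra S)" for y
    by (metis that B.meet_bottom meet_comm)
  have s: "y \<in> carrier (algebra S)" if "y \<in> sinks S" for y using that by (simp add: sinks_def)
  have J0: "\<bottom>\<^bsub>algebra S\<^esub> \<in> ?J"
    using s by (auto simp: has_no_sinks_def Delta_def act_simps bm)
  have J1: "x \<squnion>\<^bsub>algebra S\<^esub> y \<in> ?J" if "x \<in> ?J" "y \<in> ?J" for x y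
  proof -
    have "Delta S (x \<squnion>\<^bsub>algebra S\<^esub> y) \<subseteq> Delta S x \<union> Delta S y"
      using that by (auto simp: Delta_def act_simps B.join_bottom)
    moreover have "(x \<squnion>\<^bsub>algebra S\<^esub> y) \<sqinter>\<^bsub>algebra S\<^esub> w = \<bottom>\<^bsub>algebra S\<^esub>" if w: "w \<in> sinks S" for w
    proof -
      have "w \<sqinter>\<^bsub>algebra S\<^esub> x = \<bottom>\<^bsub>algebra S\<^esub>" "w \<sqinter>\<^bsub>algebra S\<^esub> y = \<bottom>\<^bsub>algebra S\<^esub>"
        using \<open>x \<in> ?J\<close> \<open>y \<in> ?J\<close> w by (simp_all add: has_no_sinks_def meet_comm[of _ w])
      then show ?thesis
        using \<open>x \<in> ?J\<close> \<open>y \<in> ?J\<close> s[OF w] B.distributive[of w x y]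
        by (simp add: meet_comm[of _ "x \<squnion>\<^bsub>algebra S\<^esub> y" w] B.join_bottom)
    qed
    ultimately show ?thesis using that by (auto simp: has_no_sinks_def)
  qed
  have J2: "x \<sqinter>\<^bsub>algebra S\<^esub> y \<in> ?J" if "x \<in> ?J" "y \<in> carrier (algebra S)" for x y
  proof -
    have "Delta S (x \<sqinter>\<^bsub>algebra S\<^esub> y) \<subseteq> Delta S x"
      using that by (auto simp: Delta_def act_simps bm)
    moreover have "(x \<sqinter>\<^bsub>algebra S\<^esub> y) \<sqinter>\<^bsub>algebra S\<^esub> w = \<bottom>\<^bsub>algebra S\<^esub>" if w: "w \<in> sinks S" for w
    proof -
      have "(x \<sqinter>\<^bsub>algebra S\<^esub> y) \<sqinter>\<^bsub>algebra S\<^esub> w \<sqsubseteq>\<^bsub>algebra S\<^esub> x \<sqinter>\<^bsub>algebra S\<^esub> w"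
        using \<open>x \<in> ?J\<close> \<open>y \<in> carrier (algebra S)\<close> s[OF w]
        by (intro B.meet_mono) (auto simp: B.meet_left)
      then show ?thesis
        using \<open>x \<in> ?J\<close> \<open>y \<in> carrier (algebra S)\<close> w s[OF w]
        by (simp add: has_no_sinks_def B.le_bottom)
    qed
    ultimately show ?thesis using that by (auto simp: has_no_sinks_def)
  qed
  have "F_ideal S a i = ?J" using False by (simp add: F_ideal_def)
  moreover have "gba_ideal (algebra S) ?J"
    unfolding gba_ideal_def
  proof (intro conjI ballI)
    show "?J \<noteq> {}" using J0 by blast
  qed (fact J1 J2 | blast)+
  ultimately show ?thesis by simp
qed

lemma F_ideal_mono: "F_ideal S a (i - 1) \<subseteq> F_ideal S a i"
proof (cases "i - 1 = 0")
  case True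
  have "\<bottom>\<^bsub>algebra S\<^esub> \<in> F_ideal S a i"
  proof -
    obtain x where x: "x \<in> F_ideal S a i" "x \<in> carrier (algebra S)"
      using F_ideal_is_ideal unfolding gba_ideal_def by blast
    then have "x \<sqinter>\<^bsub>algebra S\<^esub> \<bottom>\<^bsub>algebra S\<^esub> \<in> F_ideal S a i"
      using F_ideal_is_ideal[of i] unfolding gba_ideal_def by blast
    then show ?thesis using x by (simp add: B.meet_bottom)
  qed
  then show ?thesis using True by (simp add: F_ideal_def)
next
  case False
  then show ?thesis by (force simp: F_ideal_def)
qed

lemma F_summand_gba: "generalized_boolean_algebra (F_summand S a i)"
  unfolding F_summand_def by (rule B.quotient_gba[OF F_ideal_is_ideal])

lemma F_summands_gba: "\<forall>i. generalized_boolean_algebra (F_summand S a i)"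
  using F_summand_gba by blast

lemma F_class_closed: "A \<in> carrier (algebra S) \<Longrightarrow> F_class S a i A \<in> carrier (F_summand S a i)"
  unfolding F_summand_def F_class_def by (rule B.ideal_class_closed)

lemma F_class_cases:
  assumes "C \<in> carrier (F_summand S a i)"
  obtains A where "A \<in> carrier (algebra S)" "C = F_class S a i A"
  using assms unfolding F_summand_def F_class_def by (rule B.ideal_class_cases)

lemmas F_class_operations = B.ideal_class_operations[OF F_ideal_is_ideal,
    folded F_class_def F_summand_def]

lemma id_morphism: "gba_morphism (algebra S) (algebra S) (\<lambda>x. x)"
  by (rule gba_morphismI) (auto simp: B)

lemma act_F_ideal: "1 \<le> i \<Longrightarrow> act S (a i) ` F_ideal S a i \<subseteq> F_ideal S a 0"
proof
  fix y assume i: "1 \<le> i" and "y \<in> act S (a i) ` F_ideal S a i"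
  then obtain U where U: "U \<in> F_ideal S a i" "y = act S (a i) U" by blast
  have "a i \<notin> a ` {1..<i}"
    using enum i unfolding bij_betw_def inj_on_def by fastforce
  then have "act S (a i) U = \<bottom>\<^bsub>algebra S\<^esub>"
    using U i letter[OF i] by (auto simp: F_ideal_def Delta_def)
  then show "y \<in> F_ideal S a 0" using U by (simp add: F_ideal_def)
qed

lemma F_act_b_value:
  assumes "A \<in> carrier (algebra S)"
  shows "the_elem (F_class S a i ` F_class S a (i - 1) A) = F_class S a i A"
  using induced_value[OF B F_ideal_is_ideal F_ideal_is_ideal id_morphism _ assms] F_ideal_mono
  unfolding F_class_def by auto

lemma F_act_a_value:
  assumes "A \<in> carrier (algebra S)" "1 \<le> i"
  shows "the_elem ((\<lambda>A. F_class S a 0 (act S (a i) A)) ` F_class S a i A) =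
    F_class S a 0 (act S (a i) A)"
  using induced_value[OF B F_ideal_is_ideal F_ideal_is_ideal act_morphism[OF letter] act_F_ideal] assms
  unfolding F_class_def by auto

lemma F_act_morphism:
  assumes "\<beta> \<in> F_alphabet S"
  shows "gba_morphism (F_algebra S a) (F_algebra S a) (F_act S a \<beta>)"
proof -
  consider i where "\<beta> = Inr i" "1 \<le> i" | i where "\<beta> = Inl (a i)" "1 \<le> i"
    using assms enum unfolding F_alphabet_def bij_betw_def by fastforce
  then show ?thesis
  proof cases
    case 1
    have "gba_morphism (F_summand S a (i - 1)) (F_summand S a i) (\<lambda>C. the_elem (F_class S a i ` C))"
      using induced_morphism[OF B F_ideal_is_ideal F_ideal_is_ideal id_morphism] F_ideal_mono
      unfolding F_summand_def F_class_def by auto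
    from coord_morphism[OF F_summands_gba this] show ?thesis
      using 1 by (simp add: F_algebra_def F_act.simps[abs_def] del: One_nat_def)
  next
    case 2
    have "gba_morphism (F_summand S a i) (F_summand S a 0)
        (\<lambda>C. the_elem ((\<lambda>A. F_class S a 0 (act S (a i) A)) ` C))"
      using induced_morphism[OF B F_ideal_is_ideal F_ideal_is_ideal act_morphism[OF letter] act_F_ideal] 2
      unfolding F_summand_def F_class_def by auto
    from coord_morphism[OF F_summands_gba this] show ?thesis
      using 2 index[OF 2(2)] by (simp add: F_algebra_def F_act.simps[abs_def] del: One_nat_def)
  qed
qed

lemma F_act_values:
  assumes i: "1 \<le> i" and A: "A \<in> carrier (algebra S)"
  shows "F_act S a (Inr i) (F_elem S a (i - 1) A) = F_elem S a i A"
    and "j \<noteq> i - 1 \<Longrightarrow> F_act S a (Inr i) (F_elem S a j A) = \<bottom>\<^bsub>F_algebra S a\<^esub>"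
    and "F_act S a (Inl (a i)) (F_elem S a i A) = F_elem S a 0 (act S (a i) A)"
    and "j \<noteq> i \<Longrightarrow> F_act S a (Inl (a i)) (F_elem S a j A) = \<bottom>\<^bsub>F_algebra S a\<^esub>"
proof -
  have b: "coord (F_summand S a) j (F_class S a j \<bottom>\<^bsub>algebra S\<^esub>) = \<bottom>\<^bsub>F_algebra S a\<^esub>" for j
    unfolding F_algebra_def
    by (rule ext) (simp add: coord_def direct_sum_operations(1)[OF F_summands_gba] F_class_operations)
  note v = F_act_b_value[OF B.bottom_closed, of i] F_act_a_value[OF B.bottom_closed i]
  show "F_act S a (Inr i) (F_elem S a (i - 1) A) = F_elem S a i A"
    using F_act_b_value[OF A, of i]
    by (simp add: coord_def[of _ "i - 1"] del: One_nat_def)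
  show "F_act S a (Inl (a i)) (F_elem S a i A) = F_elem S a 0 (act S (a i) A)"
    using F_act_a_value[OF A i] by (simp add: index[OF i] coord_def[of _ i] del: One_nat_def)
  show "F_act S a (Inr i) (F_elem S a j A) = \<bottom>\<^bsub>F_algebra S a\<^esub>" if "j \<noteq> i - 1"
    using that v(1) b[of i] by (simp add: coord_def[of _ j] del: One_nat_def flip: F_class_operations(1))
  show "F_act S a (Inl (a i)) (F_elem S a j A) = \<bottom>\<^bsub>F_algebra S a\<^esub>" if "j \<noteq> i"
    using that v(2) b[of 0] letter[OF i]
    by (simp add: coord_def[of _ j] index[OF i] act_simps del: One_nat_def flip: F_class_operations(1))
qed

lemma F_elem_closed: "A \<in> carrier (algebra S) \<Longrightarrow> F_elem S a i A \<in> carrier (F_algebra S a)"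
  unfolding F_algebra_def by (intro coord_closed F_summands_gba F_class_closed)

lemma F_elem_ideal:
  assumes J: "gba_ideal (algebra S) J"
  shows "gba_ideal (F_algebra S a) (F_elem S a i ` J)"
proof -
  have c: "A \<in> carrier (algebra S)" if "A \<in> J" for A using J that by (auto simp: gba_ideal_def)
  have "F_elem S a i A \<squnion>\<^bsub>F_algebra S a\<^esub> F_elem S a i A' \<in> F_elem S a i ` J" if "A \<in> J" "A' \<in> J" for A A'
  proof -
    have "F_elem S a i A \<squnion>\<^bsub>F_algebra S a\<^esub> F_elem S a i A' = F_elem S a i (A \<squnion>\<^bsub>algebra S\<^esub> A')"
      using that F_elem_closed[OF c]
      by (simp add: F_algebra_def c F_class_operations F_class_closed
          coord_operations(2)[OF F_summands_gba _ _ F_elem_closed[OF c, unfolded F_algebra_def]])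
    then show ?thesis using J that by (auto simp: gba_ideal_def)
  qed
  moreover have "F_elem S a i A \<sqinter>\<^bsub>F_algebra S a\<^esub> f \<in> F_elem S a i ` J"
    if "A \<in> J" "f \<in> carrier (F_algebra S a)" for A f
  proof -
    have f: "f \<in> carrier (direct_sum (F_summand S a))" using that by (simp add: F_algebra_def)
    obtain A' where A': "A' \<in> carrier (algebra S)" "f i = F_class S a i A'"
      using F_class_cases direct_sum_carrierD[OF f] by metis
    have "F_elem S a i A \<sqinter>\<^bsub>F_algebra S a\<^esub> f = F_elem S a i (A \<sqinter>\<^bsub>algebra S\<^esub> A')"
      using that A' f F_class_closed[OF c]
      by (simp add: F_algebra_def c F_class_operations
          coord_operations(3)[OF F_summands_gba F_class_closed[OF c] F_class_closed[OF c] f])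
    then show ?thesis using J that A' by (auto simp: gba_ideal_def)
  qed
  moreover have "F_elem S a i ` J \<subseteq> carrier (F_algebra S a)" using c F_elem_closed by blast
  moreover have "F_elem S a i ` J \<noteq> {}" using J by (auto simp: gba_ideal_def)
  ultimately show ?thesis unfolding gba_ideal_def by blast
qed

lemma below_coord:
  assumes f: "f \<in> carrier (F_algebra S a)" and le: "f \<sqsubseteq>\<^bsub>F_algebra S a\<^esub> coord (F_summand S a) i C"
  shows "f = coord (F_summand S a) i (f i)" "f i \<sqsubseteq>\<^bsub>F_summand S a i\<^esub> C"
proof -
  interpret Q: generalized_boolean_algebra "F_summand S a j" for j by (rule F_summand_gba)
  have "f j \<sqsubseteq>\<^bsub>F_summand S a j\<^esub> coord (F_summand S a) i C j" for j
    using le by (simp add: F_algebra_def direct_sum_def)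
  moreover have fc: "f j \<in> carrier (F_summand S a j)" for j
    using f by (simp add: F_algebra_def direct_sum_carrierD)
  ultimately have "f j = \<bottom>\<^bsub>F_summand S a j\<^esub>" if "j \<noteq> i" for j
    using that by (metis Q.le_bottom coord_def)
  then show "f = coord (F_summand S a) i (f i)" by (intro ext) (simp add: coord_def)
  show "f i \<sqsubseteq>\<^bsub>F_summand S a i\<^esub> C" using \<open>f i \<sqsubseteq>\<^bsub>F_summand S a i\<^esub> coord (F_summand S a) i C i\<close>
    by (simp add: coord_def)
qed

lemma F_system_is_gbds: "generalized_boolean_dynamical_system (F_system S a)"
proof -
  have I: "gba_ideal (algebra S) (act_ideal S \<alpha>)"
    "\<And>A B. \<lbrakk>A \<in> carrier (algebra S); B \<in> carrier (algebra S); A \<sqsubseteq>\<^bsub>algebra S\<^esub> act S \<alpha> B\<rbrakk>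
      \<Longrightarrow> A \<in> act_ideal S \<alpha>" if "\<alpha> \<in> alphabet S" for \<alpha>
    using gbds that by (auto simp: generalized_boolean_dynamical_system_def)
  have J: "gba_ideal (algebra S) (carrier (algebra S))"
    by (auto simp: gba_ideal_def)
  have K: "gba_ideal (F_algebra S a) (F_act_ideal S a \<beta>)" if "\<beta> \<in> F_alphabet S" for \<beta>
    using that I J by (auto simp: F_alphabet_def F_elem_ideal)
  have "f \<in> F_act_ideal S a \<beta>"
    if \<beta>: "\<beta> \<in> F_alphabet S" and f: "f \<in> carrier (F_algebra S a)" and g: "g \<in> carrier (F_algebra S a)"
      and le: "f \<sqsubseteq>\<^bsub>F_algebra S a\<^esub> F_act S a \<beta> g" for \<beta> f g
  proof -
    have fg: "f j \<in> carrier (F_summand S a j)" "g j \<in> carrier (F_summand S a j)" for j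
      using f g by (simp_all add: F_algebra_def direct_sum_carrierD)
    consider i where "\<beta> = Inr i" "1 \<le> i" | i where "\<beta> = Inl (a i)" "1 \<le> i"
      using \<beta> enum unfolding F_alphabet_def bij_betw_def by fastforce
    then show ?thesis
    proof cases
      case 1
      obtain A where "A \<in> carrier (algebra S)" "f i = F_class S a i A"
        using F_class_cases fg by metis
      moreover have "f = coord (F_summand S a) i (f i)" using below_coord(1)[OF f] le 1 by simp
      ultimately show ?thesis using 1 by (auto simp: image_iff)
    next
      case 2
      obtain A where A: "A \<in> carrier (algebra S)" "f 0 = F_class S a 0 A"
        using F_class_cases fg by metis
      obtain B where B: "B \<in> carrier (algebra S)" "g i = F_class S a i B"
        using F_class_cases fg by metis
      have le': "f \<sqsubseteq>\<^bsub>F_algebra S a\<^esub> coord (F_summand S a) 0 (F_class S a 0 (act S (a i) B))"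
        using le 2 B F_act_a_value[OF B(1) 2(2)] by (simp add: index del: One_nat_def)
      have aB: "act S (a i) B \<in> carrier (algebra S)" using 2 B letter by (simp add: act_simps)
      have "A \<sqsubseteq>\<^bsub>algebra S\<^esub> act S (a i) B"
        using below_coord(2)[OF f le'] A aB
          B.ideal_class_le[OF F_ideal_is_ideal[of 0] A(1) aB]
        by (simp add: F_summand_def F_class_def F_ideal_def B.join_bottom)
      then have "A \<in> act_ideal S (a i)" using I 2 A B letter by blast
      moreover have "f = F_elem S a 0 A" using below_coord(1)[OF f le'] A by simp
      ultimately show ?thesis using 2 by auto
    qed
  qed
  then show ?thesis
    using K F_act_morphism direct_sum_gba[OF F_summands_gba]
    by (auto simp: generalized_boolean_dynamical_system_def F_system_def F_algebra_def)
qed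

end

end

theory Submission
  imports Defs
begin

text \<open>
  Let \<open>f\<close> be a nonzero element of the direct sum. It has only finitely many nonzero
  coordinates, and a letter can act nontrivially on \<open>f\<close> only through the single coordinate that
  it reads: \<open>a\<^sub>i\<close> reads coordinate \<open>i\<close> and \<open>b\<^sub>i\<close> reads coordinate \<open>i - 1\<close>. So only finitely many
  letters act nontrivially on \<open>f\<close>.

  At least one letter does. Choose \<open>k\<close> with \<open>f k = [A]\<^sub>k\<close> nonzero, that is, with \<open>A\<close> outside the
  ideal \<open>X\<^sub>k\<close>. If \<open>A\<close> is also outside \<open>X\<^sub>k\<^sub>+\<^sub>1\<close>, then \<open>b\<^sub>k\<^sub>+\<^sub>1\<close> sends \<open>f\<close> to \<open>[A]\<^sub>k\<^sub>+\<^sub>1\<close>, which is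
  nonzero. If \<open>A\<close> lies in \<open>X\<^sub>k\<^sub>+\<^sub>1\<close> but not in \<open>X\<^sub>k\<close>, then \<open>k \<ge> 1\<close> and \<open>a\<^sub>k\<close> is the one letter by
  which the two ideals differ, so \<open>a\<^sub>k\<close> acts nontrivially on \<open>A\<close> and hence on \<open>f\<close>. This is where
  the condition on sinks enters: a nonzero element of \<open>X\<^sub>1\<close> would be a sink disjoint from itself,
  so \<open>X\<^sub>1 = X\<^sub>0\<close>.
\<close>

lemma (in generalized_boolean_algebra) ideal_class_eq_bottom_iff:
  assumes K: "gba_ideal B K" and x: "x \<in> carrier B"
  shows "ideal_class B K x = \<bottom>\<^bsub>quotient_algebra B K\<^esub> \<longleftrightarrow> x \<in> K"
proof -
  have u: "\<bottom> \<squnion> u = u" if "u \<in> carrier B" for u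
    using that by (metis join_bottom join_comm)
  have KB: "K \<subseteq> carrier B" using K by (simp add: gba_ideal_def)
  have "ideal_class B K x = \<bottom>\<^bsub>quotient_algebra B K\<^esub> \<longleftrightarrow> (\<exists>u\<in>K. x \<sqsubseteq> u)"
    using KB x u le_mod_of_le[OF K bottom_lower bottom_closed, of x]
    by (auto simp: ideal_class_eq[OF K x bottom_closed] subset_iff
        simp flip: ideal_class_operations(1)[OF K])
  also have "\<dots> \<longleftrightarrow> x \<in> K"
  proof
    assume "\<exists>u\<in>K. x \<sqsubseteq> u"
    then obtain u where u: "u \<in> K" "x \<sqsubseteq> u" by blast
    then have "x = u \<sqinter> x" using KB x by (metis le_iff_join meet_comm subsetD)
    moreover have "u \<sqinter> x \<in> K" using K u(1) x by (simp add: gba_ideal_def)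
    ultimately show "x \<in> K" by simp
  qed (use x in auto)
  finally show ?thesis .
qed

lemma coord_eq_bottom_iff:
  assumes "\<forall>i. generalized_boolean_algebra (B i)"
  shows "coord B i x = \<bottom>\<^bsub>direct_sum B\<^esub> \<longleftrightarrow> x = \<bottom>\<^bsub>B i\<^esub>"
  by (auto simp: direct_sum_operations(1)[OF assms] coord_def fun_eq_iff)

context enumerated_gbds
begin

lemma F_class_eq_bottom_iff:
  "A \<in> carrier (algebra S) \<Longrightarrow> F_class S a i A = \<bottom>\<^bsub>F_summand S a i\<^esub> \<longleftrightarrow> A \<in> F_ideal S a i"
  unfolding F_class_def F_summand_def by (rule B.ideal_class_eq_bottom_iff[OF F_ideal_is_ideal])

lemma F_act_b_eq_bottom_iff:
  assumes "A \<in> carrier (algebra S)" "f (i - 1) = F_class S a (i - 1) A"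
  shows "F_act S a (Inr i) f = \<bottom>\<^bsub>F_algebra S a\<^esub> \<longleftrightarrow> A \<in> F_ideal S a i"
  using assms F_act_b_value[OF assms(1), of i]
  by (simp add: F_algebra_def coord_eq_bottom_iff[OF F_summands_gba] F_class_eq_bottom_iff
      del: One_nat_def)

lemma F_act_a_eq_bottom_iff:
  assumes "A \<in> carrier (algebra S)" "f i = F_class S a i A" "1 \<le> i"
  shows "F_act S a (Inl (a i)) f = \<bottom>\<^bsub>F_algebra S a\<^esub> \<longleftrightarrow> act S (a i) A = \<bottom>\<^bsub>algebra S\<^esub>"
proof -
  have "act S (a i) A \<in> carrier (algebra S)" using assms letter by (simp add: act_simps)
  then show ?thesis
    using assms F_act_a_value[OF assms(1,3)] F_class_eq_bottom_iff[of "act S (a i) A" 0]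
    by (simp add: index F_algebra_def coord_eq_bottom_iff[OF F_summands_gba] F_ideal_def
        del: One_nat_def)
qed

text \<open>Passing from \<open>X\<^sub>k\<close> to \<open>X\<^sub>k\<^sub>+\<^sub>1\<close> permits only \<open>a\<^sub>k\<close> as a further letter of \<open>\<Delta>\<^sub>A\<close>. For
  \<open>k = 0\<close> there is no such letter, and no element is gained because an element of \<open>X\<^sub>1\<close> is both
  a sink and disjoint from all sinks.\<close>

lemma F_ideal_step:
  assumes A: "A \<in> F_ideal S a (Suc k)" "A \<notin> F_ideal S a k"
  shows "1 \<le> k" and "act S (a k) A \<noteq> \<bottom>\<^bsub>algebra S\<^esub>"
proof -
  have Ac: "A \<in> carrier (algebra S)" and ns: "has_no_sinks S A"
    and D: "Delta S A \<subseteq> a ` {1..<Suc k}"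
    using A(1) by (auto simp: F_ideal_def)
  show k: "1 \<le> k"
  proof (rule ccontr)
    assume "\<not> 1 \<le> k"
    then have "A \<in> sinks S" using D Ac by (simp add: sinks_def)
    then have "A \<sqinter>\<^bsub>algebra S\<^esub> A = \<bottom>\<^bsub>algebra S\<^esub>" using ns by (simp add: has_no_sinks_def)
    moreover have "A \<sqinter>\<^bsub>algebra S\<^esub> A = A" using B.le_iff_join[OF Ac Ac] B.le_refl[OF Ac] by simp
    ultimately show False using A(2) \<open>\<not> 1 \<le> k\<close> by (simp add: F_ideal_def)
  qed
  have "\<not> Delta S A \<subseteq> a ` {1..<k}" using A(2) k Ac ns by (simp add: F_ideal_def)
  moreover have "{1..<Suc k} = insert k {1..<k}" using k by auto
  ultimately have "a k \<in> Delta S A" using D by auto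
  then show "act S (a k) A \<noteq> \<bottom>\<^bsub>algebra S\<^esub>" by (simp add: Delta_def)
qed

lemma finite_Delta_F_system:
  assumes f: "f \<in> carrier (F_algebra S a)"
  shows "finite (Delta (F_system S a) f)"
proof -
  let ?supp = "{i. f i \<noteq> \<bottom>\<^bsub>F_summand S a i\<^esub>}"
  have "Delta (F_system S a) f \<subseteq> (\<lambda>i. Inl (a i)) ` ?supp \<union> (\<lambda>i. Inr (Suc i)) ` ?supp"
  proof
    fix \<beta> assume "\<beta> \<in> Delta (F_system S a) f"
    then have \<beta>: "\<beta> \<in> F_alphabet S" "F_act S a \<beta> f \<noteq> \<bottom>\<^bsub>F_algebra S a\<^esub>"
      by (simp_all add: Delta_def F_system_def)
    \<comment> \<open>An empty coordinate is the class of the empty element, whose image under any letter is empty.\<close>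
    have cls: "f j = F_class S a j \<bottom>\<^bsub>algebra S\<^esub>" if "j \<notin> ?supp" for j
      using that F_class_operations(1) by simp
    have bot: "\<bottom>\<^bsub>algebra S\<^esub> \<in> F_ideal S a j" for j
      using F_class_eq_bottom_iff[OF B.bottom_closed] F_class_operations(1) by simp
    consider i where "\<beta> = Inr (Suc i)" | i where "\<beta> = Inl (a i)" "1 \<le> i"
      using \<beta>(1) enum unfolding F_alphabet_def bij_betw_def
      by (fastforce simp: image_iff Suc_le_eq gr0_conv_Suc)
    then show "\<beta> \<in> (\<lambda>i. Inl (a i)) ` ?supp \<union> (\<lambda>i. Inr (Suc i)) ` ?supp"
    proof cases
      case 1
      then have "i \<in> ?supp"
        using \<beta>(2) cls[of i] bot F_act_b_eq_bottom_iff[OF B.bottom_closed, of f "Suc i"] by auto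
      then show ?thesis using 1 by blast
    next
      case 2
      then have "i \<in> ?supp"
        using \<beta>(2) cls[of i] act_simps(2)[OF letter[OF 2(2)]]
          F_act_a_eq_bottom_iff[OF B.bottom_closed _ 2(2), of f] by auto
      then show ?thesis using 2 by blast
    qed
  qed
  moreover have "finite ?supp" using f by (simp add: F_algebra_def direct_sum_def)
  ultimately show ?thesis by (meson finite_UnI finite_imageI finite_subset)
qed

lemma Delta_F_system_nonempty:
  assumes f: "f \<in> carrier (F_algebra S a)" "f \<noteq> \<bottom>\<^bsub>F_algebra S a\<^esub>"
  shows "Delta (F_system S a) f \<noteq> {}"
proof -
  obtain k where k: "f k \<noteq> \<bottom>\<^bsub>F_summand S a k\<^esub>"
    using f(2) direct_sum_operations(1)[OF F_summands_gba] by (auto simp: F_algebra_def fun_eq_iff)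
  obtain A where A: "A \<in> carrier (algebra S)" "f k = F_class S a k A"
    using F_class_cases direct_sum_carrierD f(1) unfolding F_algebra_def by metis
  have Ak: "A \<notin> F_ideal S a k" using k A F_class_eq_bottom_iff by simp
  show ?thesis
  proof (cases "A \<in> F_ideal S a (Suc k)")
    case False
    then have "F_act S a (Inr (Suc k)) f \<noteq> \<bottom>\<^bsub>F_algebra S a\<^esub>"
      using F_act_b_eq_bottom_iff[OF A(1), of f "Suc k"] A(2) by simp
    moreover have "Inr (Suc k) \<in> F_alphabet S" by (simp add: F_alphabet_def)
    ultimately show ?thesis by (auto simp: Delta_def F_system_def simp del: F_act.simps)
  next
    case True
    note step = F_ideal_step[OF True Ak]
    have "F_act S a (Inl (a k)) f \<noteq> \<bottom>\<^bsub>F_algebra S a\<^esub>"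
      using F_act_a_eq_bottom_iff[of A f k] A step by simp
    moreover have "Inl (a k) \<in> F_alphabet S" using letter[OF step(1)] by (simp add: F_alphabet_def)
    ultimately show ?thesis by (auto simp: Delta_def F_system_def simp del: F_act.simps)
  qed
qed

end

theorem theorem7p5:
  fixes S :: "('a, 'l) gbds" and a :: "nat \<Rightarrow> 'l"
  assumes "generalized_boolean_dynamical_system S"
    and "bij_betw a {1..} (alphabet S)"
  shows "regular_elements (F_system S a) = carrier (algebra (F_system S a))"
proof -
  interpret enumerated_gbds S a by (rule enumerated_gbds.intro) (fact assms)+
  have "algebra (F_system S a) = F_algebra S a" by (simp add: F_system_def)
  then show ?thesis
    using finite_Delta_F_system Delta_F_system_nonempty
    by (auto simp: regular_elements_def card_gt_0_iff)
qed

end
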